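(* For $n\ge1$ define $b(n)$ by $b(n) = M(n+h,h)$, where $h\ge1$ is any integer with $h+1 \le n+h \le 2^h$. Then $b$ is well-defined (the value $M(n+h,h)$ does not depend on the choice of such $h$), and $b(n) = a_0(n)$ for all $n\ge1$, where $a_0(n)$ is the number of leaves among the first $n$ nodes of the infinite labelled forest $\mathcal{F}_0$.
   Context: An extended binary tree is a finite rooted ordered tree in which every node has either no children (a leaf) or two children (an internal node). The root is at level $0$; the height is the length of the longest path from the root to a leaf. For $h\ge1$, $M(m,h)$ is the maximum number of leaf pairs at level $h$ (equivalently, of internal nodes at level $h-1$) over all extended binary trees with $m$ leaves and height $h$. The labelled nodes of $\mathcal{F}_0$ form a succession of complete binary trees: an initial single-node tree (one leaf), followed for $h=1,2,3,\ldots$ by a complete binary tree with $2^h-1$ nodes (so the sizes are $1,1,3,7,15,\ldots$). Labels $1,2,3,\ldots$ are given to the nodes tree by tree in this order, and within each tree in preorder. $a_0(n)$ is the number of leaves among the nodes labelled $1,\ldots,n$. *)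

theory Defs
  imports "HOL-Library.Tree"
begin

text \<open>
  Extended binary trees are rendered as \<^typ>\<open>unit tree\<close>: internal nodes are \<^const>\<open>Node\<close>,
  leaves are \<^const>\<open>Leaf\<close>. Thus \<^const>\<open>size1\<close> is the number of leaves, and \<^const>\<open>height\<close> is the
  number of edges on a longest path from the root to a leaf. A node is represented by the
  subtree rooted at it; distinct nodes may have equal subtrees, so nodes are collected in
  lists rather than sets.
\<close>

type_synonym ebtree = "unit tree"

fun level_nodes :: "nat \<Rightarrow> ebtree \<Rightarrow> ebtree list" where
  "level_nodes 0 t = [t]"
| "level_nodes (Suc k) Leaf = []"
| "level_nodes (Suc k) (Node l u r) = level_nodes k l @ level_nodes k r"

text \<open>
  A leaf pair at level \<open>h \<ge> 1\<close> consists of two sibling leaves at level \<open>h\<close>; it is counted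
  at its parent, on level \<open>h - 1\<close>.
\<close>

definition leaf_pairs :: "nat \<Rightarrow> ebtree \<Rightarrow> nat" where
  "leaf_pairs h t =
     length (filter (\<lambda>s. s = Node Leaf () Leaf) (level_nodes (h - 1) t))"

lemma height_level_nodes:
  "s \<in> set (level_nodes k t) \<Longrightarrow> height s + k \<le> height t"
proof (induction k t rule: level_nodes.induct)
  case (3 k l u r)
  then have "height s + k \<le> height l \<or> height s + k \<le> height r" by auto
  then show ?case by (simp add: le_max_iff_disj)
qed simp_all

lemma leaf_pairs_eq_internal_nodes:
  assumes "h \<ge> 1" and "height t = h"
  shows "leaf_pairs h t = length (filter (\<lambda>s. s \<noteq> Leaf) (level_nodes (h - 1) t))"
proof -
  have "s = Node Leaf () Leaf \<longleftrightarrow> s \<noteq> Leaf" if "s \<in> set (level_nodes (h - 1) t)" for s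
    using height_level_nodes[OF that] assms by (cases s) auto
  then show ?thesis
    unfolding leaf_pairs_def by (simp cong: filter_cong)
qed

text \<open>Meaningful if \<open>h \<ge> 1\<close> and some tree has \<open>m\<close> leaves and height \<open>h\<close>,
  that is, if \<open>h + 1 \<le> m \<le> 2 ^ h\<close>.\<close>

definition M :: "nat \<Rightarrow> nat \<Rightarrow> nat" where
  "M m h = Max {leaf_pairs h t |t. size1 t = m \<and> height t = h}"

lemma leaf_pairs_le_size1: "leaf_pairs h t \<le> size1 t"
proof -
  have "length (level_nodes k t) \<le> size1 t" for k
    by (induction k t rule: level_nodes.induct) (simp_all add: size1_size)
  then show ?thesis
    unfolding leaf_pairs_def using le_trans[OF length_filter_le] by blast
qed

lemma finite_leaf_pairs: "finite {leaf_pairs h t |t. size1 t = m \<and> height t = h}"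
  by (rule finite_subset[of _ "{..m}"]) (use leaf_pairs_le_size1 in auto)

definition admissible :: "nat \<Rightarrow> nat \<Rightarrow> bool" where
  "admissible n h \<longleftrightarrow> h \<ge> 1 \<and> h + 1 \<le> n + h \<and> n + h \<le> 2 ^ h"

definition b :: "nat \<Rightarrow> nat" where
  "b n = (THE v. \<exists>h. admissible n h \<and> v = M (n + h) h)"

fun preorder_nodes :: "ebtree \<Rightarrow> ebtree list" where
  "preorder_nodes Leaf = [Leaf]"
| "preorder_nodes (Node l u r) = Node l u r # preorder_nodes l @ preorder_nodes r"

fun complete_tree :: "nat \<Rightarrow> ebtree" where
  "complete_tree 0 = Leaf"
| "complete_tree (Suc k) = Node (complete_tree k) () (complete_tree k)"

lemma complete_complete_tree: "complete (complete_tree k)"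
  by (induction k) auto

lemma length_preorder_complete_tree:
  "length (preorder_nodes (complete_tree k)) + 1 = 2 ^ (k + 1)"
  by (induction k) simp_all

text \<open>
  The succession of trees of the forest: the initial single-node tree at position \<open>0\<close>, then
  for \<open>h \<ge> 1\<close> the complete binary tree with \<open>2 ^ h - 1\<close> nodes (leaves included), whose
  height is \<open>h - 1\<close>.
\<close>

fun F0 :: "nat \<Rightarrow> ebtree" where
  "F0 0 = Leaf"
| "F0 (Suc k) = complete_tree k"

text \<open>
  The pair \<open>(j, i)\<close> with \<open>i < length (preorder_nodes (F0 j))\<close> stands for the node of \<open>F0 j\<close>
  at preorder position \<open>i\<close>, counted from \<open>0\<close>; labels start at \<open>1\<close>.
\<close>

definition F0_label :: "nat \<Rightarrow> nat \<Rightarrow> nat" where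
  "F0_label j i = (\<Sum>k<j. length (preorder_nodes (F0 k))) + i + 1"

definition a0 :: "nat \<Rightarrow> nat" where
  "a0 n = card {(j, i). i < length (preorder_nodes (F0 j)) \<and>
                        preorder_nodes (F0 j) ! i = Leaf \<and> F0_label j i \<le> n}"

lemma finite_F0_label_le:
  "finite {(j, i). i < length (preorder_nodes (F0 j)) \<and>
                   preorder_nodes (F0 j) ! i = Leaf \<and> F0_label j i \<le> n}"
proof (rule finite_subset)
  have pos: "1 \<le> length (preorder_nodes t)" for t
    by (cases t) auto
  have "j \<le> (\<Sum>k<j. length (preorder_nodes (F0 k)))" for j
    using sum_mono[of "{..<j}" "\<lambda>_. 1" "\<lambda>k. length (preorder_nodes (F0 k))"] pos by simp
  then have "j + i + 1 \<le> F0_label j i" for j i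
    unfolding F0_label_def by (simp add: add_mono)
  then have "j \<le> n \<and> i \<le> n" if "F0_label j i \<le> n" for j i
    using that le_trans[of "j + i + 1" "F0_label j i" n] by simp
  then show "{(j, i). i < length (preorder_nodes (F0 j)) \<and>
                      preorder_nodes (F0 j) ! i = Leaf \<and> F0_label j i \<le> n} \<subseteq> {..n} \<times> {..n}"
    by blast
qed simp

end

theory Submission
  imports Defs
begin

text \<open>
  The internal nodes of a tree with \<open>m\<close> leaves and height at most \<open>k + 1\<close> form a set of \<open>m - 1\<close>
  nodes of the complete tree of height \<open>k\<close>, closed under parents, and the leaf pairs at level
  \<open>k + 1\<close> are its members on the bottom level. The number of these is largest when the set is an
  initial segment of the preorder. The optimality of initial segments reduces to an inequality
  between leaf counts of such segments, proved by induction on \<open>k\<close>.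

  On the other hand, the preorder of the complete tree of height \<open>k\<close> consists of \<open>k\<close> internal
  nodes followed by the preorders of the first \<open>k + 1\<close> trees of the forest. Hence the optimum
  for \<open>m = n + k + 1\<close> is the number of leaves among the first \<open>n\<close> labelled nodes.
\<close>

section \<open>Leaf counts of initial preorder segments\<close>

definition preorder_leaves :: "nat \<Rightarrow> nat \<Rightarrow> nat" where
  "preorder_leaves k s = count_list (take s (preorder_nodes (complete_tree k))) Leaf"

lemma preorder_leaves_0 [simp]: "preorder_leaves k 0 = 0"
  by (simp add: preorder_leaves_def)

lemma preorder_leaves_single: "preorder_leaves 0 s = min s 1"
  by (cases s) (simp_all add: preorder_leaves_def)

lemma length_preorder_complete_tree': "length (preorder_nodes (complete_tree k)) = 2 ^ Suc k - 1"
  using length_preorder_complete_tree[of k] by simp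

text \<open>The root comes first, then the left subtree with its \<open>2 ^ Suc k - 1\<close> nodes,
  then the right one; \<open>take\<close> and truncated subtraction cover segments ending in
  either.\<close>

lemma preorder_leaves_Suc:
  "preorder_leaves (Suc k) (Suc s) = preorder_leaves k s + preorder_leaves k (s - (2 ^ Suc k - 1))"
  by (simp add: preorder_leaves_def length_preorder_complete_tree' del: power_Suc)

lemma preorder_leaves_mono: "s \<le> s' \<Longrightarrow> preorder_leaves k s \<le> preorder_leaves k s'"
  by (metis preorder_leaves_def le_add_diff_inverse take_add count_list_append le_add1)

lemma preorder_leaves_saturated:
  "2 ^ Suc k - 1 \<le> s \<Longrightarrow> preorder_leaves k s = preorder_leaves k (2 ^ Suc k - 1)"
  by (simp add: preorder_leaves_def length_preorder_complete_tree' del: power_Suc)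

text \<open>Preorder starts with the leftmost path, whose \<open>k\<close> internal nodes are
  followed by a leaf.\<close>

lemma preorder_leaves_pos: "k < s \<Longrightarrow> 0 < preorder_leaves k s"
proof (induction k arbitrary: s)
  case (Suc k)
  then show ?case by (cases s) (auto simp: preorder_leaves_Suc)
qed (simp add: preorder_leaves_single)

text \<open>Exchange step for optimality: nodes spread over two sibling subtrees can be moved so
  that the left one fills first, without losing leaves. Cutting off the roots reduces this to
  smaller height.\<close>

lemma preorder_leaves_add_le:
  "preorder_leaves k x + preorder_leaves k y
     \<le> preorder_leaves k (x + y) + preorder_leaves k (x + y - (2 ^ Suc k - 1))"
proof (induction k arbitrary: x y)
  case 0
  then show ?case by (simp add: preorder_leaves_single)
next
  case (Suc k)
  define N :: nat where "N = 2 ^ Suc k - 1"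
  have N: "2 ^ Suc (Suc k) - 1 = Suc (2 * N)"
  proof -
    have "2 ^ Suc k = Suc N"
      by (simp add: N_def)
    then show ?thesis
      unfolding power_Suc[of _ "Suc k"] by simp
  qed
  define c where "c = preorder_leaves k"
  define c' where "c' = preorder_leaves (Suc k)"
  have c'_Suc: "c' (Suc s) = c s + c (s - N)" for s
    unfolding c'_def c_def N_def by (rule preorder_leaves_Suc)
  have IH: "c x + c y \<le> c (x + y) + c (x + y - N)" for x y
    using Suc.IH unfolding c_def N_def .
  have c_0: "c 0 = 0"
    by (simp add: c_def)
  have mono: "s \<le> s' \<Longrightarrow> c s \<le> c s'" for s s'
    unfolding c_def by (rule preorder_leaves_mono)
  have sat: "N \<le> s \<Longrightarrow> c s = c N" for s
    unfolding c_def N_def by (rule preorder_leaves_saturated)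
  \<comment> \<open>The claim for \<open>x = Suc u\<close> and \<open>y = Suc v\<close>: the merged
    segment needs one root instead of two, which frees the extra node in \<open>Suc (u + v)\<close>.
    Here one left subtree is full, so only its excess \<open>d\<close> is merged with
    \<open>v\<close>.\<close>
  have full_part: "c u + c (u - N) + (c v + c (v - N))
      \<le> c (Suc (u + v)) + c (Suc (u + v) - N) + c' (Suc (u + v) - 2 * N)"
    if "N \<le> u" "v \<le> N" for u v
  proof -
    define d where "d = u - N"
    with that have u: "u = N + d" by simp
    have "c (d + v - N) \<le> c' (Suc (d + v) - N)"
      by (cases "d + v < N") (simp_all add: c_0 c'_Suc Suc_diff_le)
    moreover have "c (d + v) \<le> c (Suc (d + v))"
      by (simp add: mono)
    moreover have "c u = c N" "c (Suc (u + v)) = c N"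
      using that by (auto intro: sat)
    moreover have "Suc (u + v) - N = Suc (d + v)" "Suc (u + v) - 2 * N = Suc (d + v) - N"
      using u by auto
    ultimately show ?thesis
      using IH[of d v] that by (simp add: c_0 flip: d_def)
  qed
  have key: "c u + c (u - N) + (c v + c (v - N))
      \<le> c (Suc (u + v)) + c (Suc (u + v) - N) + c' (Suc (u + v) - 2 * N)" for u v
  proof -
    consider "u \<le> N" "v \<le> N" | "N \<le> u" "v \<le> N" | "u \<le> N" "N \<le> v" | "N \<le> u" "N \<le> v"
      by linarith
    then show ?thesis
    proof cases
      case 1
      \<comment> \<open>Neither segment leaves its left subtree: the freed node can only help, and
        the overflow term is dropped.\<close>
      have "c (u + v) \<le> c (Suc (u + v))" "c (u + v - N) \<le> c (Suc (u + v) - N)"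
        by (auto intro: mono)
      with 1 show ?thesis
        using IH[of u v] by (simp add: c_0)
    next
      case 2
      then show ?thesis by (rule full_part)
    next
      case 3
      then show ?thesis
        using full_part[of v u] by (simp add: add.commute)
    next
      case 4
      \<comment> \<open>Both left subtrees are full and cancel. The freed node becomes the root of
        the overflow segment, which unfolds to the right side of \<open>IH\<close>.\<close>
      define d e where "d = u - N" and "e = v - N"
      have "c u = c N" "c v = c N" "c (Suc (u + v)) = c N" "c (Suc (u + v) - N) = c N"
        using 4 by (auto intro: sat)
      moreover have "Suc (u + v) - 2 * N = Suc (d + e)"
        using 4 by (simp add: d_def e_def)
      ultimately show ?thesis
        using IH[of d e] by (simp add: c'_Suc flip: d_def e_def)
    qed
  qed
  have "c' x + c' y \<le> c' (x + y) + c' (x + y - Suc (2 * N))"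
  proof (cases "x = 0 \<or> y = 0")
    case False
    then obtain u v where "x = Suc u" "y = Suc v"
      by (meson not0_implies_Suc)
    then show ?thesis
      using key[of u v] by (simp add: c'_Suc)
  qed (auto simp: c'_def)
  then show ?case
    by (simp only: c'_def N)
qed

section \<open>The maximal number of leaf pairs\<close>

lemma leaf_pairs_Node:
  "leaf_pairs (Suc (Suc k)) (Node l u r) = leaf_pairs (Suc k) l + leaf_pairs (Suc k) r"
  by (simp add: leaf_pairs_def)

text \<open>Deleting the root splits the count over two subtrees; the exchange inequality merges
  their bounds into one segment of the taller complete tree.\<close>

lemma leaf_pairs_le_preorder_leaves: "leaf_pairs (Suc k) t \<le> preorder_leaves k (size t)"
proof (induction k arbitrary: t)
  case 0
  then show ?case by (auto simp: leaf_pairs_def preorder_leaves_single)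
next
  case (Suc k)
  show ?case
  proof (cases t)
    case Leaf
    then show ?thesis by (simp add: leaf_pairs_def)
  next
    case (Node l u r)
    have "leaf_pairs (Suc k) l + leaf_pairs (Suc k) r
        \<le> preorder_leaves k (size l) + preorder_leaves k (size r)"
      by (intro add_mono Suc.IH)
    also note preorder_leaves_add_le
    finally show ?thesis
      by (simp add: Node leaf_pairs_Node preorder_leaves_Suc del: power_Suc)
  qed
qed

text \<open>The internal nodes are placed along the preorder. The height is only bounded, since the
  subtree taking the overflow may be shallow, even a leaf.\<close>

lemma ex_tree_preorder_leaves:
  assumes "s < 2 ^ Suc k"
  shows "\<exists>t::ebtree. size t = s \<and> height t \<le> Suc k \<and> leaf_pairs (Suc k) t = preorder_leaves k s"
  using assms
proof (induction k arbitrary: s)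
  case 0
  then have "s = 0 \<or> s = 1" by auto
  then show ?case
  proof
    assume "s = 0"
    then show ?case by (intro exI[of _ Leaf]) (simp add: leaf_pairs_def)
  next
    assume "s = 1"
    then show ?case
      by (intro exI[of _ "Node Leaf () Leaf"]) (simp add: leaf_pairs_def preorder_leaves_single)
  qed
next
  case (Suc k)
  show ?case
  proof (cases s)
    case 0
    then show ?thesis by (intro exI[of _ Leaf]) (simp add: leaf_pairs_def)
  next
    case (Suc s')
    define N :: nat where "N = 2 ^ Suc k - 1"
    have N: "2 ^ Suc k = Suc N"
      by (simp add: N_def)
    \<comment> \<open>The left subtree is filled first, up to its capacity \<open>N\<close>; the
      right one gets the rest.\<close>
    have "min s' N < 2 ^ Suc k" "s' - N < 2 ^ Suc k"
      using Suc.prems Suc N by auto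
    then obtain l r :: ebtree
      where l: "size l = min s' N" "height l \<le> Suc k"
          "leaf_pairs (Suc k) l = preorder_leaves k (min s' N)"
        and r: "size r = s' - N" "height r \<le> Suc k"
          "leaf_pairs (Suc k) r = preorder_leaves k (s' - N)"
      by (meson Suc.IH)
    have "preorder_leaves k (min s' N) = preorder_leaves k s'"
      using preorder_leaves_saturated[of k s'] by (simp add: N_def min_def)
    then show ?thesis using l r Suc
      by (intro exI[of _ "Node l () r"])
        (simp add: leaf_pairs_Node preorder_leaves_Suc N del: power_Suc)
  qed
qed

lemma leaf_pairs_pos_imp_height: "0 < leaf_pairs (Suc k) t \<Longrightarrow> Suc k \<le> height t"
  using height_level_nodes[of "Node Leaf () Leaf" k t]
  by (auto simp: leaf_pairs_def filter_empty_conv)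

lemma M_eq_preorder_leaves:
  assumes "k < s" "s < 2 ^ Suc k"
  shows "M (Suc s) (Suc k) = preorder_leaves k s"
  unfolding M_def
proof (rule Max_eqI[OF finite_leaf_pairs])
  fix y
  assume "y \<in> {leaf_pairs (Suc k) t |t. size1 t = Suc s \<and> height t = Suc k}"
  then show "y \<le> preorder_leaves k s"
    using leaf_pairs_le_preorder_leaves by (auto simp: size1_size)
next
  obtain t :: ebtree where t: "size t = s" "height t \<le> Suc k"
      "leaf_pairs (Suc k) t = preorder_leaves k s"
    using ex_tree_preorder_leaves assms(2) by blast
  \<comment> \<open>By \<open>k < s\<close> there is a leaf pair at level \<open>Suc k\<close>, so
    the height bound is attained.\<close>
  then have "height t = Suc k"
    using leaf_pairs_pos_imp_height[of k t] preorder_leaves_pos[OF assms(1)] by simp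
  with t show "preorder_leaves k s
      \<in> {leaf_pairs (Suc k) t |t. size1 t = Suc s \<and> height t = Suc k}"
    by (auto simp: size1_size intro!: exI[of _ t])
qed

section \<open>Leaves of the labelled forest\<close>

definition forest_nodes :: "nat \<Rightarrow> ebtree list" where
  "forest_nodes k = concat (map (\<lambda>j. preorder_nodes (F0 j)) [0..<k])"

lemma forest_nodes_Suc: "forest_nodes (Suc k) = forest_nodes k @ preorder_nodes (F0 k)"
  by (simp add: forest_nodes_def)

lemma length_forest_nodes: "length (forest_nodes k) = (\<Sum>j<k. length (preorder_nodes (F0 j)))"
  by (induction k) (simp_all add: forest_nodes_Suc, simp add: forest_nodes_def)

text \<open>\<open>xs\<close> is the left spine. Passing to the next height prepends a new root and
  appends its right subtree, which is the next tree of the forest.\<close>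

lemma preorder_complete_tree_eq_forest_nodes:
  "\<exists>xs. preorder_nodes (complete_tree k) = xs @ forest_nodes (Suc k)
      \<and> length xs = k \<and> Leaf \<notin> set xs"
proof (induction k)
  case 0
  then show ?case by (simp add: forest_nodes_def)
next
  case (Suc k)
  then obtain xs where "preorder_nodes (complete_tree k) = xs @ forest_nodes (Suc k)"
      "length xs = k" "Leaf \<notin> set xs"
    by blast
  then show ?case
    by (intro exI[of _ "complete_tree (Suc k) # xs"]) (simp add: forest_nodes_Suc[of "Suc k"])
qed

text \<open>Thus the first \<open>Suc k\<close> trees have exactly as many nodes as the largest
  \<open>n\<close> admissible for height \<open>Suc k\<close>.\<close>

lemma length_forest_nodes_Suc: "length (forest_nodes (Suc k)) + Suc k = 2 ^ Suc k"
  using preorder_complete_tree_eq_forest_nodes[of k] length_preorder_complete_tree[of k] by auto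

lemma preorder_leaves_eq_forest_nodes:
  "preorder_leaves k (n + k) = count_list (take n (forest_nodes (Suc k))) Leaf"
proof -
  obtain xs where "preorder_nodes (complete_tree k) = xs @ forest_nodes (Suc k)"
      "length xs = k" "Leaf \<notin> set xs"
    using preorder_complete_tree_eq_forest_nodes by blast
  then show ?thesis
    by (simp add: preorder_leaves_def)
qed

lemma count_list_take_eq_card:
  "count_list (take n xs) x = card {i. i < length xs \<and> xs ! i = x \<and> i < n}"
proof -
  have "count_list (take n xs) x = card {i. i < length (take n xs) \<and> x = take n xs ! i}"
    by (simp only: count_list_eq_length_filter length_filter_conv_card)
  also have "{i. i < length (take n xs) \<and> x = take n xs ! i}
      = {i. i < length xs \<and> xs ! i = x \<and> i < n}"
    by auto
  finally show ?thesis .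
qed

lemma card_F0_label_le_eq_forest_nodes:
  "card {(j, i). j < k \<and> i < length (preorder_nodes (F0 j)) \<and>
                 preorder_nodes (F0 j) ! i = Leaf \<and> F0_label j i \<le> n}
     = count_list (take n (forest_nodes k)) Leaf"
proof (induction k)
  case 0
  then show ?case by (simp add: forest_nodes_def)
next
  case (Suc k)
  define A where "A = (\<lambda>k. {(j, i). j < k \<and> i < length (preorder_nodes (F0 j)) \<and>
                 preorder_nodes (F0 j) ! i = Leaf \<and> F0_label j i \<le> n})"
  \<comment> \<open>In tree \<open>k\<close> the label bound becomes a bound on the position; the
    difference is \<open>0\<close> when \<open>n\<close> does not reach that tree.\<close>
  define B where "B = {i. i < length (preorder_nodes (F0 k)) \<and> preorder_nodes (F0 k) ! i = Leaf \<and>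
                 i < n - length (forest_nodes k)}"
  have "finite (A k)"
    unfolding A_def by (rule finite_subset[OF _ finite_F0_label_le[of n]]) auto
  moreover have "finite B"
    unfolding B_def by simp
  moreover have "A (Suc k) = A k \<union> Pair k ` B"
    unfolding A_def B_def
    by (auto simp: F0_label_def length_forest_nodes less_Suc_eq)
  moreover have "A k \<inter> Pair k ` B = {}"
    unfolding A_def by auto
  ultimately have "card (A (Suc k)) = card (A k) + card B"
    by (simp add: card_Un_disjoint card_image inj_on_def)
  also have "card B = count_list (take (n - length (forest_nodes k)) (preorder_nodes (F0 k))) Leaf"
    unfolding B_def by (rule count_list_take_eq_card[symmetric])
  finally show ?case
    using Suc.IH unfolding A_def by (simp add: forest_nodes_Suc)
qed

text \<open>Labels in later trees exceed \<open>length (forest_nodes k)\<close>, hence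
  \<open>n\<close>, so only the first \<open>k\<close> trees contribute.\<close>

lemma a0_eq_forest_nodes:
  assumes "n \<le> length (forest_nodes k)"
  shows "a0 n = count_list (take n (forest_nodes k)) Leaf"
proof -
  have "j < k" if "F0_label j i \<le> n" for j i
  proof (rule ccontr)
    assume "\<not> j < k"
    then have "length (forest_nodes k) \<le> length (forest_nodes j)"
      unfolding length_forest_nodes by (intro sum_mono2) auto
    with that assms show False
      by (simp add: F0_label_def length_forest_nodes)
  qed
  then have "{(j, i). i < length (preorder_nodes (F0 j)) \<and>
                      preorder_nodes (F0 j) ! i = Leaf \<and> F0_label j i \<le> n}
      = {(j, i). j < k \<and> i < length (preorder_nodes (F0 j)) \<and>
                 preorder_nodes (F0 j) ! i = Leaf \<and> F0_label j i \<le> n}"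
    by blast
  then show ?thesis
    unfolding a0_def by (simp only: card_F0_label_le_eq_forest_nodes)
qed

lemma M_eq_a0:
  assumes "admissible n h"
  shows "M (n + h) h = a0 n"
proof -
  \<comment> \<open>A tree with \<open>n + Suc k\<close> leaves has \<open>n + k\<close> internal
    nodes, and \<open>1 \<le> n\<close> gives \<open>k < n + k\<close>.\<close>
  obtain k where k: "h = Suc k" "1 \<le> n" "n + Suc k \<le> 2 ^ Suc k"
    using assms unfolding admissible_def by (cases h) auto
  then have "M (n + h) h = preorder_leaves k (n + k)"
    using M_eq_preorder_leaves[of k "n + k"] by simp
  also have "\<dots> = a0 n"
    using a0_eq_forest_nodes[of n "Suc k"] k length_forest_nodes_Suc[of k]
    by (simp add: preorder_leaves_eq_forest_nodes)
  finally show ?thesis .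
qed

lemma ex_admissible:
  assumes "1 \<le> n"
  shows "\<exists>h. admissible n h"
proof -
  have "n + Suc n \<le> 2 ^ Suc n"
    using less_exp[of n] unfolding power_Suc by linarith
  with assms have "admissible n (Suc n)"
    unfolding admissible_def by simp
  then show ?thesis ..
qed

theorem corollary3p5:
  fixes n :: nat
  assumes "n \<ge> 1"
  shows "(\<exists>h. admissible n h) \<and>
         (\<forall>h h'. admissible n h \<longrightarrow> admissible n h' \<longrightarrow> M (n + h) h = M (n + h') h') \<and>
         b n = a0 n"
proof -
  \<comment> \<open>Some \<open>h\<close> is admissible and every such \<open>h\<close> gives
    \<open>a0 n\<close>, so the predicate under \<open>THE\<close> is equality with
    \<open>a0 n\<close>.\<close>
  have "(\<lambda>v. \<exists>h. admissible n h \<and> v = M (n + h) h) = (\<lambda>v. v = a0 n)"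
    using ex_admissible[OF assms] by (force simp: M_eq_a0)
  then have "b n = a0 n"
    unfolding b_def by simp
  then show ?thesis
    using ex_admissible[OF assms] M_eq_a0 by simp
qed

end
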